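(* Let $\mathfrak n=\mathfrak U\oplus\mathfrak Z\oplus\mathfrak V\oplus\mathfrak E$ be a finite-dimensional real vector space with bases $\{u_i\}$ of $\mathfrak U$, $\{z_\alpha\}$ of $\mathfrak Z$, $\{v_i\}$ of $\mathfrak V$ (indexed by the same set as $\{u_i\}$), $\{e_a\}$ of $\mathfrak E$, and with the inner product whose only nonzero values on pairs of basis vectors are $\langle u_i,v_i\rangle=1$, $\langle z_\alpha,z_\alpha\rangle=\varepsilon_\alpha$, $\langle e_a,e_a\rangle=\bar\varepsilon_a$, each $\varepsilon_\alpha,\bar\varepsilon_a\in\{1,-1\}$. Let $\iota:\mathfrak n\to\mathfrak n$ be the linear involution $\iota u_i=v_i$, $\iota v_i=u_i$, $\iota z_\alpha=\varepsilon_\alpha z_\alpha$, $\iota e_a=\bar\varepsilon_a e_a$. Let $j:\mathfrak U\oplus\mathfrak Z\to\operatorname{End}(\mathfrak V\oplus\mathfrak E)$ be a linear map such that for all $a\in\mathfrak U\oplus\mathfrak Z$ and $x\in\mathfrak V\oplus\mathfrak E$ $$\langle j(a)x,\iota j(a)x\rangle=\langle a,\iota a\rangle\langle x,\iota x\rangle,\qquad j(a)^2=-\langle a,\iota a\rangle I .$$ Define $[x,y]\in\mathfrak U\oplus\mathfrak Z$ for $x,y\in\mathfrak V\oplus\mathfrak E$ by $\langle[x,y],\iota a\rangle=\langle j(a)x,\iota y\rangle$ for all $a\in\mathfrak U\oplus\mathfrak Z$, and extend to $\mathfrak n$ by $[a+x,b+y]=[x,y]$ for $a,b\in\mathfrak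 U\oplus\mathfrak Z$, $x,y\in\mathfrak V\oplus\mathfrak E$. Then, endowed with this structure, $\mathfrak n$ is a 2-step nilpotent Lie algebra of $pH$-type with center $\mathfrak U\oplus\mathfrak Z$.
   Context: An inner product is a nondegenerate symmetric bilinear form (not necessarily definite). A Lie algebra $\mathfrak n$ with center $\mathfrak z$ is called 2-step nilpotent when $[\mathfrak n,\mathfrak n]\subseteq\mathfrak z$. A 2-step nilpotent Lie algebra $\mathfrak n$ with center $\mathfrak z=\mathfrak U\oplus\mathfrak Z$ and with decomposition, inner product and involution $\iota$ as in the claim has an associated linear map $j:\mathfrak U\oplus\mathfrak Z\to\operatorname{End}(\mathfrak V\oplus\mathfrak E)$ characterized by $\langle j(a)x,\iota y\rangle=\langle[x,y],\iota a\rangle$ for $a\in\mathfrak U\oplus\mathfrak Z$, $x,y\in\mathfrak V\oplus\mathfrak E$. It is of $pH$-type if $j(a)^2=-\langle a,\iota a\rangle I$ on $\mathfrak V\oplus\mathfrak E$ for every $a\in\mathfrak U\oplus\mathfrak Z$.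
   Formalization: The formal theorem assumes that U⊕Z is nonzero or V⊕E is zero; if U=Z=V=0 and E is nonzero, then j=0 meets all hypotheses but n=E is abelian with center E, not U⊕Z=0, so the claim fails. *)

theory Defs
  imports "HOL-Analysis.Analysis" "HOL-Library.Set_Algebras"
begin

definition basis_of :: "'i set \<Rightarrow> ('i \<Rightarrow> 'a::real_vector) \<Rightarrow> 'a set \<Rightarrow> bool" where
  "basis_of I b S \<longleftrightarrow> inj_on b I \<and> independent (b ` I) \<and> span (b ` I) = S"

text \<open>The whole space is the internal direct sum of four subspaces.\<close>

definition direct_sum4 ::
  "'a::real_vector set \<Rightarrow> 'a set \<Rightarrow> 'a set \<Rightarrow> 'a set \<Rightarrow> bool" where
  "direct_sum4 U Z V E \<longleftrightarrow>
     subspace U \<and> subspace Z \<and> subspace V \<and> subspace E \<and>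
     (\<forall>x. \<exists>!t. t \<in> U \<times> Z \<times> V \<times> E \<and> (case t of (p, q, r, s) \<Rightarrow> x = p + q + r + s))"

text \<open>Inner products are not assumed to be definite, so the class \<open>real_inner\<close> does not apply.\<close>

definition inner_product :: "('a::real_vector \<Rightarrow> 'a \<Rightarrow> real) \<Rightarrow> bool" where
  "inner_product ip \<longleftrightarrow>
     bilinear ip \<and> (\<forall>x y. ip x y = ip y x) \<and> (\<forall>x. (\<forall>y. ip x y = 0) \<longrightarrow> x = 0)"

text \<open>Endomorphisms of a subspace \<open>W\<close> are represented by total functions whose values outside
  \<open>W\<close> are irrelevant.\<close>

definition End_on :: "'a::real_vector set \<Rightarrow> ('a \<Rightarrow> 'a) set" where
  "End_on W = {f. (\<forall>x\<in>W. f x \<in> W) \<and> (\<forall>x\<in>W. \<forall>y\<in>W. f (x + y) = f x + f y) \<and>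
                  (\<forall>c. \<forall>x\<in>W. f (c *\<^sub>R x) = c *\<^sub>R f x)}"

definition linear_to_End ::
  "'a::real_vector set \<Rightarrow> 'a set \<Rightarrow> ('a \<Rightarrow> 'a \<Rightarrow> 'a) \<Rightarrow> bool" where
  "linear_to_End C W j \<longleftrightarrow>
     (\<forall>a\<in>C. j a \<in> End_on W) \<and>
     (\<forall>a\<in>C. \<forall>b\<in>C. \<forall>x\<in>W. j (a + b) x = j a x + j b x) \<and>
     (\<forall>c. \<forall>a\<in>C. \<forall>x\<in>W. j (c *\<^sub>R a) x = c *\<^sub>R j a x)"

definition lie_bracket :: "('a::real_vector \<Rightarrow> 'a \<Rightarrow> 'a) \<Rightarrow> bool" where
  "lie_bracket br \<longleftrightarrow>
     bilinear br \<and> (\<forall>x. br x x = 0) \<and>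
     (\<forall>x y w. br x (br y w) + br y (br w x) + br w (br x y) = 0)"

definition lie_center :: "('a::real_vector \<Rightarrow> 'a \<Rightarrow> 'a) \<Rightarrow> 'a set" where
  "lie_center br = {x. \<forall>y. br x y = 0}"

definition derived_algebra :: "('a::real_vector \<Rightarrow> 'a \<Rightarrow> 'a) \<Rightarrow> 'a set" where
  "derived_algebra br = span {br x y | x y. True}"

text \<open>Abelian algebras are allowed.\<close>

definition two_step_nilpotent :: "('a::real_vector \<Rightarrow> 'a \<Rightarrow> 'a) \<Rightarrow> bool" where
  "two_step_nilpotent br \<longleftrightarrow> derived_algebra br \<subseteq> lie_center br"

text \<open>In what follows \<open>C\<close> stands for \<open>U + Z\<close> and \<open>W\<close> for \<open>V + E\<close>; the form is \<open>ip\<close> and the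
  involution is \<open>\<iota>\<close>.\<close>

definition associated_map ::
  "('a::real_vector \<Rightarrow> 'a \<Rightarrow> real) \<Rightarrow> ('a \<Rightarrow> 'a) \<Rightarrow> 'a set \<Rightarrow> 'a set \<Rightarrow>
   ('a \<Rightarrow> 'a \<Rightarrow> 'a) \<Rightarrow> ('a \<Rightarrow> 'a \<Rightarrow> 'a) \<Rightarrow> bool" where
  "associated_map ip \<iota> C W br j \<longleftrightarrow>
     linear_to_End C W j \<and>
     (\<forall>a\<in>C. \<forall>x\<in>W. \<forall>y\<in>W. ip (j a x) (\<iota> y) = ip (br x y) (\<iota> a))"

text \<open>The associated map is determined on \<open>C\<close> and \<open>W\<close> when \<open>ip x (\<iota> y)\<close> is nondegenerate
  on \<open>W\<close>, so the existential quantifier below refers to the associated map.\<close>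

definition pH_type ::
  "('a::real_vector \<Rightarrow> 'a \<Rightarrow> real) \<Rightarrow> ('a \<Rightarrow> 'a) \<Rightarrow> 'a set \<Rightarrow> 'a set \<Rightarrow>
   ('a \<Rightarrow> 'a \<Rightarrow> 'a) \<Rightarrow> bool" where
  "pH_type ip \<iota> C W br \<longleftrightarrow>
     lie_bracket br \<and> two_step_nilpotent br \<and> lie_center br = C \<and>
     (\<exists>j. associated_map ip \<iota> C W br j \<and>
          (\<forall>a\<in>C. \<forall>x\<in>W. j a (j a x) = - (ip a (\<iota> a)) *\<^sub>R x))"

text \<open>The bracket defined from \<open>j\<close>, first on \<open>W\<close> and then on the whole space.\<close>

definition induced_bracket ::
  "('a::real_vector \<Rightarrow> 'a \<Rightarrow> real) \<Rightarrow> ('a \<Rightarrow> 'a) \<Rightarrow> 'a set \<Rightarrow> 'a set \<Rightarrow>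
   ('a \<Rightarrow> 'a \<Rightarrow> 'a) \<Rightarrow> ('a \<Rightarrow> 'a \<Rightarrow> 'a) \<Rightarrow> bool" where
  "induced_bracket ip \<iota> C W j br \<longleftrightarrow>
     (\<forall>x\<in>W. \<forall>y\<in>W. br x y \<in> C \<and> (\<forall>a\<in>C. ip (br x y) (\<iota> a) = ip (j a x) (\<iota> y))) \<and>
     (\<forall>a\<in>C. \<forall>b\<in>C. \<forall>x\<in>W. \<forall>y\<in>W. br (a + x) (b + y) = br x y)"

end

theory Submission
  imports Defs
begin

text \<open>The twisted form \<open>\<langle>x, \<iota> y\<rangle>\<close> is positive definite: the four bases together are orthonormal
  for it. The norm condition polarizes to \<open>\<langle>j(a)x, \<iota> j(a)y\<rangle> = \<langle>a, \<iota> a\<rangle>\<langle>x, \<iota> y\<rangle>\<close>, and putting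
  \<open>j(a)y\<close> for \<open>y\<close> and using \<open>j(a)\<^sup>2 = -\<langle>a, \<iota> a\<rangle>I\<close> shows that each \<open>j(a)\<close> is skew, so the bracket
  is alternating. It takes values in \<open>U + Z\<close>, which is central, so the Jacobi identity is trivial.
  For \<open>a \<noteq> 0\<close> the map \<open>j(a)\<close> is injective by \<open>j(a)\<^sup>2 = -\<langle>a, \<iota> a\<rangle>I\<close>, so no nonzero \<open>x\<close> in
  \<open>V + E\<close> is central.\<close>

section \<open>Bilinear forms with a finite orthonormal set\<close>

locale orthonormal_frame =
  fixes g :: "'a::real_vector \<Rightarrow> 'a \<Rightarrow> real" and T :: "'a set"
  assumes bil: "bilinear g"
    and fin: "finite T"
    and unit: "t \<in> T \<Longrightarrow> g t t = 1"
    and orth: "\<lbrakk>s \<in> T; t \<in> T; s \<noteq> t\<rbrakk> \<Longrightarrow> g s t = 0"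
begin

lemmas g_simps = bilinear_ladd[OF bil] bilinear_radd[OF bil] bilinear_lmul[OF bil]
  bilinear_rmul[OF bil] bilinear_lzero[OF bil] bilinear_rzero[OF bil] bilinear_lsub[OF bil]
  bilinear_rsub[OF bil] bilinear_lneg[OF bil] bilinear_rneg[OF bil]

lemma linear_left: "linear (\<lambda>x. g x y)" and linear_right: "linear (g x)"
  using bil by (simp_all add: bilinear_def)

lemma subframe: "S \<subseteq> T \<Longrightarrow> orthonormal_frame g S"
  using bil fin unit orth by unfold_locales (auto intro: finite_subset simp: subset_iff)

lemma coeff_left:
  assumes "s \<in> T"
  shows "g (\<Sum>t\<in>T. f t *\<^sub>R t) s = f s"
proof -
  have "g (\<Sum>t\<in>T. f t *\<^sub>R t) s = (\<Sum>t\<in>T. f t * g t s)"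
    by (simp add: linear_sum[OF linear_left] g_simps)
  also have "\<dots> = (\<Sum>t\<in>T. if t = s then f t else 0)"
    using assms by (intro sum.cong) (auto simp: unit orth)
  finally show ?thesis using fin assms by simp
qed

lemma expansion:
  assumes "x \<in> span T"
  shows "(\<Sum>t\<in>T. g x t *\<^sub>R t) = x"
  using assms
proof (induction rule: span_induct)
  show "subspace {x. (\<Sum>t\<in>T. g x t *\<^sub>R t) = x}"
    by (auto simp: subspace_def g_simps scaleR_add_left sum.distrib simp flip: scaleR_scaleR scaleR_sum_right)
next
  fix x assume x: "x \<in> T"
  have "(\<Sum>t\<in>T. g x t *\<^sub>R t) = (\<Sum>t\<in>T. if x = t then t else 0)"
    using x by (intro sum.cong) (auto simp: unit orth)
  then show "(\<Sum>t\<in>T. g x t *\<^sub>R t) = x" using fin x by simp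
qed

text \<open>Expanding \<open>y\<close> alone suffices, and for \<open>x\<close> in the span too the
  sum is symmetric in \<open>x\<close> and \<open>y\<close>. So symmetry of \<open>g\<close> and,
  from a sum of squares at \<open>x = y\<close>, definiteness follow on the span without being
  assumed.\<close>

lemma sum_coeff:
  assumes "y \<in> span T"
  shows "g x y = (\<Sum>t\<in>T. g y t * g x t)"
proof -
  have "g x y = g x (\<Sum>t\<in>T. g y t *\<^sub>R t)" by (simp only: expansion[OF assms])
  also have "\<dots> = (\<Sum>t\<in>T. g y t * g x t)"
    by (simp add: linear_sum[OF linear_right] g_simps)
  finally show ?thesis .
qed

lemma sym: "\<lbrakk>x \<in> span T; y \<in> span T\<rbrakk> \<Longrightarrow> g x y = g y x"
  by (simp add: sum_coeff mult.commute)

lemma definite: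
  assumes "x \<in> span T" "g x x = 0"
  shows "x = 0"
proof -
  have "(\<Sum>t\<in>T. g x t * g x t) = 0" using assms sum_coeff by metis
  then have "\<forall>t\<in>T. g x t = 0" using fin by (simp add: sum_nonneg_eq_0_iff)
  then show ?thesis using expansion[OF assms(1)] by simp
qed

end

text \<open>\<open>S\<close> is to be the basis of U + Z and \<open>R\<close> that of V + E; the
  form and the involution enter only through \<open>ip x (\<iota> y)\<close>. The condition
  \<open>nontriv\<close> excludes \<open>span S = {0}\<close> with
  \<open>span R \<noteq> {0}\<close>: there the bracket vanishes and the center is the whole space
  instead of \<open>span S\<close>.\<close>

locale pH_data =
  fixes ip :: "'a::real_vector \<Rightarrow> 'a \<Rightarrow> real" and \<iota> :: "'a \<Rightarrow> 'a"
    and S R :: "'a set" and j :: "'a \<Rightarrow> 'a \<Rightarrow> 'a"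
  assumes frame: "orthonormal_frame (\<lambda>x y. ip x (\<iota> y)) (S \<union> R)"
    and disj: "S \<inter> R = {}"
    and total: "span (S \<union> R) = UNIV"
    and nontriv: "span S \<noteq> {0} \<or> span R = {0}"
    and j_lin: "linear_to_End (span S) (span R) j"
    and j_isom: "\<lbrakk>a \<in> span S; x \<in> span R\<rbrakk> \<Longrightarrow> ip (j a x) (\<iota> (j a x)) = ip a (\<iota> a) * ip x (\<iota> x)"
    and j_sq: "\<lbrakk>a \<in> span S; x \<in> span R\<rbrakk> \<Longrightarrow> j a (j a x) = - (ip a (\<iota> a)) *\<^sub>R x"
begin

section \<open>The definite form \<open>g\<close> and the orthogonal splitting into \<open>C\<close>
  and \<open>W\<close>\<close>

abbreviation g where "g \<equiv> \<lambda>x y. ip x (\<iota> y)"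
abbreviation C where "C \<equiv> span S"
abbreviation W where "W \<equiv> span R"

sublocale T: orthonormal_frame g "S \<union> R" by (rule frame)
sublocale S: orthonormal_frame g S by (rule T.subframe) simp
sublocale R: orthonormal_frame g R by (rule T.subframe) simp

lemma g_sym: "g x y = g y x" using T.sym[of x y] total by simp

lemma g_definite: "g x x = 0 \<Longrightarrow> x = 0" using T.definite[of x] total by simp

lemma orthogonal:
  assumes "a \<in> C" "x \<in> W"
  shows "g a x = 0"
proof -
  have 1: "g a r = 0" if "r \<in> R" for r
    using assms(1)
  proof (induction rule: span_induct)
    show "subspace {a. g a r = 0}" by (auto simp: subspace_def T.g_simps)
    show "g s r = 0" if "s \<in> S" for s using that \<open>r \<in> R\<close> disj by (intro T.orth) auto
  qed
  show ?thesis using assms(2)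
  proof (induction rule: span_induct)
    show "subspace {x. g a x = 0}" by (auto simp: subspace_def T.g_simps)
  qed (rule 1)
qed

text \<open>Pairing with the difference \<open>a - b\<close>, itself in \<open>C\<close>, reduces
  this to definiteness. Brackets are known only through their pairings with \<open>C\<close>, so
  identities between them are proved this way.\<close>

lemma separating:
  assumes "a \<in> C" "b \<in> C" "\<And>c. c \<in> C \<Longrightarrow> g a c = g b c"
  shows "a = b"
proof -
  have "g (a - b) (a - b) = 0" using assms(3)[of "a - b"] assms(1,2)
    by (simp add: span_diff T.g_simps(7))
  then show ?thesis using g_definite by fastforce
qed

lemma decomposition:
  obtains a w where "a \<in> C" "w \<in> W" "x = a + w"
  using total span_Un[of S R] by blast

lemma j_in: "\<lbrakk>a \<in> C; x \<in> W\<rbrakk> \<Longrightarrow> j a x \<in> W"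
  and j_add_right: "\<lbrakk>a \<in> C; x \<in> W; y \<in> W\<rbrakk> \<Longrightarrow> j a (x + y) = j a x + j a y"
  and j_scale_right: "\<lbrakk>a \<in> C; x \<in> W\<rbrakk> \<Longrightarrow> j a (c *\<^sub>R x) = c *\<^sub>R j a x"
  and j_add_left: "\<lbrakk>a \<in> C; b \<in> C; x \<in> W\<rbrakk> \<Longrightarrow> j (a + b) x = j a x + j b x"
  and j_scale_left: "\<lbrakk>a \<in> C; x \<in> W\<rbrakk> \<Longrightarrow> j (c *\<^sub>R a) x = c *\<^sub>R j a x"
  using j_lin by (auto simp: linear_to_End_def End_on_def)

lemma j_zero_left: "x \<in> W \<Longrightarrow> j 0 x = 0"
  using j_scale_left[of 0 x 0] span_zero by auto

lemma j_zero_right: "a \<in> C \<Longrightarrow> j a 0 = 0"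
  using j_scale_right[of a 0 0] span_zero by auto

section \<open>Polarization and skewness of j(a)\<close>

lemma j_polarized:
  assumes a: "a \<in> C" and x: "x \<in> W" and y: "y \<in> W"
  shows "g (j a x) (j a y) = g a a * g x y"
proof -
  have "g (j a (x + y)) (j a (x + y)) = g a a * g (x + y) (x + y)"
    using a x y by (intro j_isom) (auto intro: span_add)
  then have "g (j a x) (j a x) + g (j a y) (j a y) + 2 * g (j a x) (j a y)
      = g a a * (g x x + g y y + 2 * g x y)"
    using g_sym[of "j a y" "j a x"] g_sym[of y x]
    by (simp add: j_add_right[OF a x y] T.g_simps(1,2) algebra_simps)
  then show ?thesis using j_isom[OF a x] j_isom[OF a y] by (simp add: distrib_left)
qed

lemma j_skew:
  assumes a: "a \<in> C" and x: "x \<in> W" and y: "y \<in> W"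
  shows "g (j a x) y = - g x (j a y)"
\<comment> \<open>Substituting \<open>j a y\<close> in the polarized identity yields skewness only
  up to the factor \<open>g a a\<close>, so the case a = 0 is settled separately.\<close>
proof (cases "g a a = 0")
  case True
  then have "a = 0" by (rule g_definite)
  then show ?thesis using x y by (simp add: j_zero_left T.g_simps(5,6))
next
  case False
  have "g (j a x) (j a (j a y)) = g a a * g x (j a y)"
    using a x y by (intro j_polarized j_in)
  moreover have "g (j a x) (j a (j a y)) = - g a a * g (j a x) y"
    using j_sq[OF a y] by (simp add: T.g_simps(4,10))
  ultimately have "g a a * (g (j a x) y + g x (j a y)) = 0" by (simp add: distrib_left)
  then show ?thesis using False by (simp add: eq_neg_iff_add_eq_0)
qed

lemma j_alternating: "\<lbrakk>a \<in> C; x \<in> W\<rbrakk> \<Longrightarrow> g (j a x) x = 0"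
  using j_skew[of a x x] g_sym[of "j a x" x] by simp

lemma j_injective:
  assumes "a \<in> C" "a \<noteq> 0" "x \<in> W" "j a x = 0"
  shows "x = 0"
  using j_sq[OF assms(1,3)] j_zero_right[OF assms(1)] g_definite[of a] assms by auto

section \<open>Existence and uniqueness of the induced bracket\<close>

abbreviation "induced \<equiv> induced_bracket ip \<iota> C W j"

text \<open>The \<open>g\<close>-orthogonal projection onto \<open>W\<close>, with kernel
  \<open>C\<close>. In this coefficient form its linearity is immediate from bilinearity of
  \<open>g\<close>.\<close>

definition projW :: "'a \<Rightarrow> 'a" where "projW x = (\<Sum>r\<in>R. g x r *\<^sub>R r)"

lemma projW_in: "projW x \<in> W"
  unfolding projW_def by (intro span_sum span_scale span_base)

lemma projW_sum:
  assumes "a \<in> C" "x \<in> W"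
  shows "projW (a + x) = x"
proof -
  have "projW (a + x) = (\<Sum>r\<in>R. g x r *\<^sub>R r)" unfolding projW_def
    using orthogonal[OF assms(1)] by (intro sum.cong) (auto simp: T.g_simps(1) span_base)
  then show ?thesis using R.expansion[OF assms(2)] by simp
qed

lemma projW_id: "x \<in> W \<Longrightarrow> projW x = x"
  using projW_sum[of 0 x] span_zero[of S] by simp

lemma j_coefficients:
  assumes "x \<in> W" "y \<in> W" "a \<in> C"
  shows "g (j a x) y = (\<Sum>s\<in>S. g a s * g (j s x) y)"
proof -
  \<comment> \<open>Linearity of \<open>j\<close> in its first argument is available only on
    \<open>C\<close>, so the sum is built term by term, with every partial sum kept in
    \<open>C\<close>.\<close>
  have "j (\<Sum>s\<in>F. g a s *\<^sub>R s) x = (\<Sum>s\<in>F. g a s *\<^sub>R j s x)" if "F \<subseteq> S" for F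
    using finite_subset[OF that S.fin] that
  proof (induction F rule: finite_induct)
    case empty
    then show ?case using assms by (simp add: j_zero_left)
  next
    case (insert s F)
    have "(\<Sum>s\<in>F. g a s *\<^sub>R s) \<in> C" "s \<in> C"
      using insert by (auto intro!: span_sum span_scale intro: span_base)
    then show ?case using insert assms by (simp add: j_add_left j_scale_left span_scale)
  qed
  from this[of S] have "j a x = (\<Sum>s\<in>S. g a s *\<^sub>R j s x)"
    using S.expansion[OF assms(3)] by simp
  then show ?thesis by (simp add: linear_sum[OF T.linear_left] T.g_simps(3))
qed

lemma induced_exists: "\<exists>br. induced br"
proof
  \<comment> \<open>Since \<open>S\<close> is orthonormal, the coefficient at \<open>s\<close> must
    be \<open>g (br x y) s\<close>, which the defining equation prescribes as
    \<open>g (j s x) y\<close> on \<open>W\<close>. Projecting both arguments first extends the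
    formula to all vectors.\<close>
  define br where "br = (\<lambda>x y. \<Sum>s\<in>S. g (j s (projW x)) (projW y) *\<^sub>R s)"
  have "br x y \<in> C" for x y
    unfolding br_def by (intro span_sum span_scale span_base)
  moreover have "g (br x y) a = g (j a x) y" if "x \<in> W" "y \<in> W" "a \<in> C" for x y a
    using S.sum_coeff[OF that(3), of "br x y"] S.coeff_left j_coefficients[OF that] that(1,2)
    by (simp add: br_def projW_id)
  moreover have "br (a + x) (b + y) = br x y" if "a \<in> C" "b \<in> C" "x \<in> W" "y \<in> W" for a b x y
    using that by (simp add: br_def projW_sum projW_id)
  ultimately show "induced br" unfolding induced_bracket_def by simp
qed

text \<open>Values on \<open>W\<close> are fixed by \<open>separating\<close>, and every vector
  splits into parts in \<open>C\<close> and \<open>W\<close>, so the brackets agree as total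
  functions.\<close>

lemma induced_unique:
  assumes "induced br" "induced br'"
  shows "br = br'"
proof (intro ext)
  fix p q
  obtain a x where p: "a \<in> C" "x \<in> W" "p = a + x" using decomposition .
  obtain b y where q: "b \<in> C" "y \<in> W" "q = b + y" using decomposition .
  have "br x y = br' x y"
    using assms p(2) q(2) by (intro separating) (auto simp: induced_bracket_def)
  then show "br p q = br' p q" using assms p q by (auto simp: induced_bracket_def)
qed

section \<open>The Lie algebra given by an induced bracket\<close>

context
  fixes br
  assumes br: "induced br"
begin

text \<open>The extension clause discards \<open>C\<close>-components. This turns the defining
  equation on \<open>W\<close> into \<open>br_char\<close>, valid for arbitrary arguments.\<close>

lemma br_projW: "br p q = br (projW p) (projW q)"
proof -
  obtain a x where p: "a \<in> C" "x \<in> W" "p = a + x" using decomposition .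
  obtain b y where q: "b \<in> C" "y \<in> W" "q = b + y" using decomposition .
  show ?thesis using br p q by (auto simp: induced_bracket_def projW_sum)
qed

lemma br_in: "br p q \<in> C"
  using br br_projW[of p q] projW_in by (auto simp: induced_bracket_def)

lemma br_char: "a \<in> C \<Longrightarrow> g (br p q) a = g (j a (projW p)) (projW q)"
  using br br_projW[of p q] projW_in by (auto simp: induced_bracket_def)

lemma projW_add: "projW (p + q) = projW p + projW q"
  and projW_scale: "projW (c *\<^sub>R p) = c *\<^sub>R projW p"
  by (simp_all add: projW_def T.g_simps(1,3) scaleR_add_left sum.distrib scaleR_sum_right)

text \<open>Tested against \<open>c\<close> in \<open>C\<close>, each identity becomes, through
  \<open>br_char\<close>, linearity of \<open>projW\<close>, \<open>j c\<close> and
  \<open>g\<close>.\<close>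

lemma bilinear_br: "bilinear br"
proof -
  note S.g_simps(1-4)[simp] projW_add[simp] projW_scale[simp]
  note [simp] = j_add_right j_scale_right projW_in br_char span_add span_scale br_in
  have "br (p + p') q = br p q + br p' q" "br p (q + q') = br p q + br p q'"
    "br (c *\<^sub>R p) q = c *\<^sub>R br p q" "br p (c *\<^sub>R q) = c *\<^sub>R br p q" for p p' q q' c
    by (rule separating; simp)+
  then show ?thesis by (auto simp: bilinear_def intro!: linearI)
qed

lemma br_alternating: "br p p = 0"
  by (rule separating) (auto simp: br_in br_char j_alternating projW_in S.g_simps(5) span_zero)

lemma bracket_zero_on_C:
  assumes "a \<in> C"
  shows "br a q = 0" "br q a = 0"
proof -
  have "projW a = 0" using projW_sum[OF assms, of 0] span_zero by auto
  then have "br a q = br 0 q" "br q a = br q 0"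
    using br_projW projW_id[OF span_zero] by metis+
  then show "br a q = 0" "br q a = 0"
    using bilinear_br by (simp_all add: bilinear_lzero bilinear_rzero)
qed

lemma lie_bracket_br: "lie_bracket br"
  unfolding lie_bracket_def using bilinear_br br_alternating bracket_zero_on_C(2) br_in by simp

lemma lie_center_br: "lie_center br = C"
proof
  show "C \<subseteq> lie_center br" using bracket_zero_on_C(1) by (auto simp: lie_center_def)
  show "lie_center br \<subseteq> C"
  proof
    fix p assume p: "p \<in> lie_center br"
    obtain a x where ax: "a \<in> C" "x \<in> W" "p = a + x" using decomposition .
    have "x = 0"
    proof (cases "W = {0}")
      case False
      then obtain c where c: "c \<in> C" "c \<noteq> 0" using nontriv span_zero by blast
      \<comment> \<open>The test vector \<open>j c x\<close> makes this pairing equal to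
        \<open>g (j c x) (j c x)\<close>, so centrality of \<open>p\<close> forces
        \<open>j c x = 0\<close> by definiteness.\<close>
      have "g (br p (j c x)) c = 0" using p by (simp add: lie_center_def S.g_simps(5))
      then have "g (j c x) (j c x) = 0"
        using c ax by (simp add: br_char projW_sum projW_id j_in)
      then show ?thesis using g_definite j_injective c ax(2) by blast
    qed (use ax in auto)
    then show "p \<in> C" using ax by simp
  qed
qed

lemma two_step_nilpotent_br: "two_step_nilpotent br"
  unfolding two_step_nilpotent_def derived_algebra_def lie_center_br
  using br_in by (intro span_minimal) auto

text \<open>The equation defining \<open>br\<close> from \<open>j\<close>, read from right to left,
  characterizes the associated map; thus \<open>j\<close> itself is the witness.\<close>

lemma pH_type_br: "pH_type ip \<iota> C W br"
  unfolding pH_type_def associated_map_def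
  using lie_bracket_br two_step_nilpotent_br lie_center_br j_lin j_sq br
  by (intro conjI exI[of _ j]) (auto simp: induced_bracket_def)

end

end

section \<open>The given bases as an orthonormal frame\<close>

theorem theorem7p2:
  fixes I :: "'i set" and A :: "'k set" and B :: "'e set"
    and U Z V E :: "'a::real_vector set"
    and u v :: "'i \<Rightarrow> 'a" and z :: "'k \<Rightarrow> 'a" and e :: "'e \<Rightarrow> 'a"
    and \<epsilon> :: "'k \<Rightarrow> real" and \<epsilon>' :: "'e \<Rightarrow> real"
    and ip :: "'a \<Rightarrow> 'a \<Rightarrow> real" and \<iota> :: "'a \<Rightarrow> 'a" and j :: "'a \<Rightarrow> 'a \<Rightarrow> 'a"
  assumes fin: "finite I" "finite A" "finite B"
    and dsum: "direct_sum4 U Z V E"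
    and bases: "basis_of I u U" "basis_of A z Z" "basis_of I v V" "basis_of B e E"
    and nontriv: "U + Z \<noteq> {0} \<or> V + E = {0}"
    and signs: "\<forall>\<alpha>\<in>A. \<epsilon> \<alpha> \<in> {1, -1}" "\<forall>a\<in>B. \<epsilon>' a \<in> {1, -1}"
    and ip: "inner_product ip"
    and ip_uv: "\<forall>i\<in>I. \<forall>k\<in>I. ip (u i) (v k) = (if i = k then 1 else 0)"
    and ip_zz: "\<forall>\<alpha>\<in>A. \<forall>\<beta>\<in>A. ip (z \<alpha>) (z \<beta>) = (if \<alpha> = \<beta> then \<epsilon> \<alpha> else 0)"
    and ip_ee: "\<forall>a\<in>B. \<forall>b\<in>B. ip (e a) (e b) = (if a = b then \<epsilon>' a else 0)"
    and ip_uu: "\<forall>i\<in>I. \<forall>k\<in>I. ip (u i) (u k) = 0"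
    and ip_vv: "\<forall>i\<in>I. \<forall>k\<in>I. ip (v i) (v k) = 0"
    and ip_uz: "\<forall>i\<in>I. \<forall>\<alpha>\<in>A. ip (u i) (z \<alpha>) = 0"
    and ip_ue: "\<forall>i\<in>I. \<forall>a\<in>B. ip (u i) (e a) = 0"
    and ip_vz: "\<forall>i\<in>I. \<forall>\<alpha>\<in>A. ip (v i) (z \<alpha>) = 0"
    and ip_ve: "\<forall>i\<in>I. \<forall>a\<in>B. ip (v i) (e a) = 0"
    and ip_ze: "\<forall>\<alpha>\<in>A. \<forall>a\<in>B. ip (z \<alpha>) (e a) = 0"
    and iota: "linear \<iota>"
    and iota_uv: "\<forall>i\<in>I. \<iota> (u i) = v i \<and> \<iota> (v i) = u i"
    and iota_z: "\<forall>\<alpha>\<in>A. \<iota> (z \<alpha>) = \<epsilon> \<alpha> *\<^sub>R z \<alpha>"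
    and iota_e: "\<forall>a\<in>B. \<iota> (e a) = \<epsilon>' a *\<^sub>R e a"
    and j_lin: "linear_to_End (U + Z) (V + E) j"
    and j_isom: "\<forall>a\<in>U + Z. \<forall>x\<in>V + E. ip (j a x) (\<iota> (j a x)) = ip a (\<iota> a) * ip x (\<iota> x)"
    and j_sq: "\<forall>a\<in>U + Z. \<forall>x\<in>V + E. j a (j a x) = - (ip a (\<iota> a)) *\<^sub>R x"
  shows "(\<exists>!br. induced_bracket ip \<iota> (U + Z) (V + E) j br) \<and>
         (\<forall>br. induced_bracket ip \<iota> (U + Z) (V + E) j br \<longrightarrow>
            lie_bracket br \<and> two_step_nilpotent br \<and> lie_center br = U + Z \<and>
            pH_type ip \<iota> (U + Z) (V + E) br)"
proof -
  define S where "S = u ` I \<union> z ` A"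
  define R where "R = v ` I \<union> e ` B"
  have C: "span S = U + Z" and W: "span R = V + E"
    using bases by (auto simp: S_def R_def span_Un set_plus_def basis_of_def)
  have ip_sym: "ip x y = ip y x" and bil: "bilinear ip" for x y
    using ip by (auto simp: inner_product_def)
  have sq: "\<And>\<alpha>. \<alpha> \<in> A \<Longrightarrow> \<epsilon> \<alpha> * \<epsilon> \<alpha> = 1" "\<And>a. a \<in> B \<Longrightarrow> \<epsilon>' a * \<epsilon>' a = 1"
    using signs by auto
  \<comment> \<open>Mixed values of \<open>ip\<close> are given in one order only; these instances
    of symmetry rewrite the opposite order to it.\<close>
  note ip_flip = ip_sym[of "v _" "u _"] ip_sym[of "z _" "u _"] ip_sym[of "e _" "u _"]
    ip_sym[of "z _" "v _"] ip_sym[of "e _" "v _"] ip_sym[of "e _" "z _"]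
  note ip_simps = ip_flip ip_uv ip_zz ip_ee ip_uu ip_vv ip_uz ip_ue ip_vz ip_ve ip_ze
    iota_uv iota_z iota_e bilinear_rmul[OF bil] sq
  have bil': "bilinear (\<lambda>x y. ip x (\<iota> y))"
    using bil linear_compose[OF iota] by (auto simp: bilinear_def o_def)
  \<comment> \<open>The involution sends each basis vector to its \<open>ip\<close>-dual: it swaps
    \<open>u i\<close> and \<open>v i\<close>, and on \<open>z \<alpha>\<close> and
    \<open>e a\<close> it supplies the sign that cancels the one in the form.\<close>
  have frame: "orthonormal_frame (\<lambda>x y. ip x (\<iota> y)) (S \<union> R)"
  proof
    show "finite (S \<union> R)" using fin by (simp add: S_def R_def)
    show "ip t (\<iota> t) = 1" if "t \<in> S \<union> R" for t
      using that by (auto simp: S_def R_def ip_simps)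
    show "ip s (\<iota> t) = 0" if "s \<in> S \<union> R" "t \<in> S \<union> R" "s \<noteq> t" for s t
      using that by (auto simp: S_def R_def ip_simps)
  qed (rule bil')
  have disj: "S \<inter> R = {}"
  proof -
    \<comment> \<open>A common vector would pair with itself to 0, as a member of \<open>S\<close>
      against one of \<open>R\<close>, and to 1, as a frame vector.\<close>
    have "s \<noteq> t" if "s \<in> S" "t \<in> R" for s t
    proof
      assume "s = t"
      have "ip s (\<iota> t) = 0" using that by (auto simp: S_def R_def ip_simps)
      moreover have "ip t (\<iota> t) = 1" using that(2) by (auto simp: R_def ip_simps)
      ultimately show False using \<open>s = t\<close> by simp
    qed
    then show ?thesis by blast
  qed
  have total: "span (S \<union> R) = UNIV"
  proof -
    have "x \<in> span (S \<union> R)" for x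
    proof -
      obtain t where "t \<in> U \<times> Z \<times> V \<times> E" "case t of (p, q, r, s) \<Rightarrow> x = p + q + r + s"
        using dsum unfolding direct_sum4_def by blast
      then obtain p q r s where "p \<in> U" "q \<in> Z" "r \<in> V" "s \<in> E" "x = (p + q) + (r + s)"
        by (auto simp: add.assoc)
      then show ?thesis unfolding span_Un C W by (blast intro: set_plus_intro)
    qed
    then show ?thesis by blast
  qed
  interpret pH_data ip \<iota> S R j
    using frame disj total nontriv j_lin j_isom j_sq
    by (intro pH_data.intro) (auto simp: C W)
  show ?thesis
    unfolding C[symmetric] W[symmetric]
    using induced_exists induced_unique lie_bracket_br two_step_nilpotent_br lie_center_br pH_type_br
    by blast
qed

end
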